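(* Let $\Gamma$ be a finite abelian group and let $S\subseteq\Gamma$ with $0\notin S$. Then the mixed Cayley graph $\mathrm{Cay}(\Gamma,S)$ is Eisenstein integral if and only if it is HS-integral.
   Context: $\Gamma$ is written additively. The mixed Cayley graph $\mathrm{Cay}(\Gamma,S)$ has vertex set $\Gamma$ and arc set $\{(a,b): b-a\in S\}$. Its $(0,1)$-adjacency matrix $\mathcal{A}=(a_{uv})$ has $a_{uv}=1$ if $(u,v)$ is an arc and $a_{uv}=0$ otherwise. A mixed graph is Eisenstein integral if all eigenvalues of $\mathcal{A}$ are Eisenstein integers, i.e. numbers of the form $a+b\omega_3$ with $a,b\in\mathbb{Z}$ and $\omega_3=\frac{-1+i\sqrt3}{2}$. The Hermitian adjacency matrix of second kind $\mathcal{H}=(h_{uv})$ is defined by $h_{uv}=1$ if both $(u,v)$ and $(v,u)$ are arcs, $h_{uv}=\frac{1+i\sqrt3}{2}$ if only $(u,v)$ is an arc, $h_{uv}=\frac{1-i\sqrt3}{2}$ if only $(v,u)$ is an arc, and $h_{uv}=0$ otherwise. The graph is HS-integral if all eigenvalues of $\mathcal{H}$ are integers. *)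

theory Defs
  imports "HOL-Analysis.Analysis"
begin

text \<open>A mixed graph whose vertex set is the whole (finite) type is given by its set of arcs;
  an undirected edge is a pair of opposite arcs.\<close>

definition cayley_arcs :: "'a::ab_group_add set \<Rightarrow> ('a \<times> 'a) set" where
  "cayley_arcs S = {(a, b). b - a \<in> S}"

definition adj_matrix :: "('v::finite \<times> 'v) set \<Rightarrow> complex ^ 'v ^ 'v" where
  "adj_matrix E = (\<chi> u v. if (u, v) \<in> E then 1 else 0)"

definition herm_adj_matrix :: "('v::finite \<times> 'v) set \<Rightarrow> complex ^ 'v ^ 'v" where
  "herm_adj_matrix E = (\<chi> u v.
     if (u, v) \<in> E \<and> (v, u) \<in> E then 1
     else if (u, v) \<in> E then (1 + \<i> * complex_of_real (sqrt 3)) / 2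
     else if (v, u) \<in> E then (1 - \<i> * complex_of_real (sqrt 3)) / 2
     else 0)"

definition eigenvalue :: "complex ^ 'n ^ 'n \<Rightarrow> complex \<Rightarrow> bool" where
  "eigenvalue A k \<longleftrightarrow> (\<exists>x. x \<noteq> 0 \<and> A *v x = k *s x)"

definition omega3 :: complex where
  "omega3 = (- 1 + \<i> * complex_of_real (sqrt 3)) / 2"

definition eisenstein_ints :: "complex set" where
  "eisenstein_ints = {of_int a + of_int b * omega3 | a b. True}"

definition eisenstein_integral :: "('v::finite \<times> 'v) set \<Rightarrow> bool" where
  "eisenstein_integral E \<longleftrightarrow> (\<forall>k. eigenvalue (adj_matrix E) k \<longrightarrow> k \<in> eisenstein_ints)"

definition HS_integral :: "('v::finite \<times> 'v) set \<Rightarrow> bool" where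
  "HS_integral E \<longleftrightarrow> (\<forall>k. eigenvalue (herm_adj_matrix E) k \<longrightarrow> k \<in> \<int>)"

end

theory Submission
  imports Defs "HOL-Computational_Algebra.Fundamental_Theorem_Algebra" "HOL-Number_Theory.Cong"
begin

text \<open>
  Commutativity of the group makes the adjacency matrix \<open>A\<close> of a Cayley graph normal, and
  normality is all that is needed. With \<open>c = 1 + \<omega>\<close>, the Hermitian adjacency matrix is
  \<open>c A + cnj c A\<^sup>*\<close>, and an eigenvector of \<open>A\<close> for \<open>l\<close> is one of \<open>A\<^sup>*\<close> for \<open>cnj l\<close>, so the
  eigenvalues of the Hermitian adjacency matrix are the numbers \<open>Re l - \<surd>3 Im l\<close>. These are
  integers if the \<open>l\<close> are Eisenstein integers. Conversely, as \<open>cnj l\<close> is an eigenvalue of the real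
  matrix \<open>A\<close> too, both \<open>m = Re l - \<surd>3 Im l\<close> and \<open>n = Re l + \<surd>3 Im l\<close> are integers, which makes
  \<open>l\<close> an Eisenstein integer as soon as 3 divides \<open>n - m\<close>. Now \<open>(l - cnj l)\<^sup>2 = - (n - m)\<^sup>2 / 3\<close> is a
  rational eigenvalue of the integer matrix \<open>(A - A\<^sup>T)\<^sup>2\<close>, hence an integer.
\<close>

section \<open>Eigenvectors in invariant subspaces\<close>

lemma mat_mult_nth [simp]: "(mat a ** A) $ i $ j = a * A $ i $ j"
  for A :: "'a::semiring_1 ^ 'n ^ 'm"
  by (simp add: matrix_matrix_mult_def mat_def if_distrib if_distribR cong: if_cong)

lemma mat_mult_vec [simp]: "mat a *v x = a *s x"
  for x :: "'a::semiring_1 ^ 'n"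
  by (simp add: vec_eq_iff matrix_vector_mult_def mat_def if_distrib if_distribR cong: if_cong)

text \<open>Horner's scheme for \<open>p(A) x\<close>.\<close>

definition poly_matrix_vec :: "'a::field poly \<Rightarrow> 'a ^ 'n ^ 'n \<Rightarrow> 'a ^ 'n \<Rightarrow> 'a ^ 'n" where
  "poly_matrix_vec p A x = fold_coeffs (\<lambda>a y. a *s x + A *v y) p 0"

lemma poly_matrix_vec_0 [simp]: "poly_matrix_vec 0 A x = 0"
  by (simp add: poly_matrix_vec_def)

lemma poly_matrix_vec_pCons [simp]:
  "poly_matrix_vec (pCons a p) A x = a *s x + A *v poly_matrix_vec p A x"
  by (cases "p = 0"; cases "a = 0") (simp_all add: poly_matrix_vec_def)

lemma poly_matrix_vec_add:
  "poly_matrix_vec (p + q) A x = poly_matrix_vec p A x + poly_matrix_vec q A x"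
  by (induction p q rule: poly_induct2) (simp_all add: matrix_vector_right_distrib)

lemma poly_matrix_vec_smult:
  "poly_matrix_vec (smult c p) A x = c *s poly_matrix_vec p A x"
  by (induction p) (simp_all add: vector_scalar_commute)

lemma poly_matrix_vec_linear_factor:
  "poly_matrix_vec ([:- c, 1:] * p) A x
     = A *v poly_matrix_vec p A x - c *s poly_matrix_vec p A x"
proof -
  have "[:- c, 1:] * p = smult (- c) p + pCons 0 p"
    by simp
  then show ?thesis
    by (simp only: poly_matrix_vec_add poly_matrix_vec_smult poly_matrix_vec_pCons) simp
qed

lemma poly_matrix_vec_monom: "poly_matrix_vec (monom c n) A x = c *s ((*v) A ^^ n) x"
  by (induction n) (simp_all add: monom_0 monom_Suc vector_scalar_commute)

lemma poly_matrix_vec_in_subspace: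
  assumes "vec.subspace V" "x \<in> V" "\<And>y. y \<in> V \<Longrightarrow> A *v y \<in> V"
  shows "poly_matrix_vec p A x \<in> V"
  by (induction p) (simp_all add: assms vec.subspace_0 vec.subspace_add vec.subspace_scale)

lemma exists_in_span_predecessors:
  fixes f :: "nat \<Rightarrow> 'a::field ^ 'n"
  shows "\<exists>n. f n \<in> vec.span (f ` {..<n})"
proof (rule ccontr)
  assume "\<nexists>n. f n \<in> vec.span (f ` {..<n})"
  then have notin: "f n \<notin> vec.span (f ` {..<n})" for n
    by blast
  have "vec.independent (f ` {..<n}) \<and> card (f ` {..<n}) = n" for n
  proof (induction n)
    case (Suc n)
    have "f n \<notin> f ` {..<n}"
      using notin vec.span_base[of "f n" "f ` {..<n}"] by blast
    moreover have "vec.independent (insert (f n) (f ` {..<n}))"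
      using Suc notin by (intro vec.independent_insertI) auto
    ultimately show ?case
      using Suc by (simp add: lessThan_Suc)
  qed (simp add: vec.independent_empty)
  then have "n \<le> CARD('n)" for n
    using vec.independent_card_le_dim[OF subset_UNIV] by (metis vec_dim_card)
  then show False
    using Suc_n_not_le_n by blast
qed

lemma in_span_iterates_imp_poly_matrix_vec:
  assumes "v \<in> vec.span ((\<lambda>i. ((*v) A ^^ i) x) ` {..<n})"
  shows "\<exists>p. (\<forall>i\<ge>n. coeff p i = 0) \<and> v = poly_matrix_vec p A x"
  using assms
proof (induction rule: vec.span_induct_alt)
  case base
  show ?case
    by (rule exI[of _ 0]) simp
next
  case (step c u v)
  then obtain i p where "i < n" "u = ((*v) A ^^ i) x"
    and "\<forall>i\<ge>n. coeff p i = 0" "v = poly_matrix_vec p A x"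
    by auto
  then show ?case
    by (intro exI[of _ "monom c i + p"])
      (simp add: poly_matrix_vec_add poly_matrix_vec_monom)
qed

lemma exists_annihilating_poly:
  fixes A :: "'a::field ^ 'n ^ 'n"
  shows "\<exists>p. p \<noteq> 0 \<and> poly_matrix_vec p A x = 0"
proof -
  obtain n where "((*v) A ^^ n) x \<in> vec.span ((\<lambda>i. ((*v) A ^^ i) x) ` {..<n})"
    using exists_in_span_predecessors[of "\<lambda>i. ((*v) A ^^ i) x"] by blast
  then obtain p where p: "\<forall>i\<ge>n. coeff p i = 0" "((*v) A ^^ n) x = poly_matrix_vec p A x"
    using in_span_iterates_imp_poly_matrix_vec by blast
  have "coeff (monom (- 1) n + p) n = - 1"
    using p(1) by simp
  then have "monom (- 1) n + p \<noteq> 0"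
    by (metis coeff_0 neg_equal_0_iff_equal zero_neq_one)
  moreover have "poly_matrix_vec (monom (- 1) n + p) A x = 0"
    by (simp add: poly_matrix_vec_add poly_matrix_vec_monom p(2))
  ultimately show ?thesis
    by blast
qed

lemma invariant_subspace_eigenvector:
  fixes A :: "complex ^ 'n ^ 'n"
  assumes V: "vec.subspace V" "\<And>y. y \<in> V \<Longrightarrow> A *v y \<in> V" and x: "x \<in> V" "x \<noteq> 0"
  obtains y l where "y \<in> V" "y \<noteq> 0" "A *v y = l *s y"
proof -
  let ?annihilates = "\<lambda>p. p \<noteq> 0 \<and> poly_matrix_vec p A x = 0"
  obtain p where p: "?annihilates p" and minimal: "\<And>q. ?annihilates q \<Longrightarrow> degree p \<le> degree q"
    using exists_annihilating_poly ex_has_least_nat[of ?annihilates _ degree] by blast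
  have "degree p \<noteq> 0"
  proof
    assume "degree p = 0"
    then obtain a where "p = [:a:]"
      by (rule degree_eq_zeroE)
    with p x show False
      by simp
  qed
  then obtain l where "poly p l = 0"
    using fundamental_theorem_of_algebra[of p] by (auto simp: constant_degree)
  then obtain q where q: "p = [:- l, 1:] * q"
    by (auto simp: poly_eq_0_iff_dvd)
  with p have "q \<noteq> 0"
    by auto
  then have "degree q < degree p"
    by (simp add: q degree_mult_eq del: mult_pCons_left)
  with minimal \<open>q \<noteq> 0\<close> have "poly_matrix_vec q A x \<noteq> 0"
    using not_le by blast
  moreover have "A *v poly_matrix_vec q A x = l *s poly_matrix_vec q A x"
    using p unfolding q poly_matrix_vec_linear_factor by simp
  ultimately show ?thesis
    using that poly_matrix_vec_in_subspace[OF V(1) x(1) V(2)] by blast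
qed

lemma commuting_common_eigenvector:
  fixes A B :: "complex ^ 'n ^ 'n"
  assumes "eigenvalue A k" and comm: "A ** B = B ** A"
  obtains x l where "x \<noteq> 0" "A *v x = k *s x" "B *v x = l *s x"
proof -
  obtain x where x: "x \<noteq> 0" "A *v x = k *s x"
    using assms(1) by (auto simp: eigenvalue_def)
  let ?V = "{y. A *v y = k *s y}"
  have "vec.subspace ?V"
    by (rule vec.subspaceI)
      (simp_all add: matrix_vector_right_distrib vector_scalar_commute mult.commute)
  moreover have "B *v y \<in> ?V" if "y \<in> ?V" for y
    using that by (simp add: matrix_vector_mul_assoc comm)
      (simp add: vector_scalar_commute flip: matrix_vector_mul_assoc)
  ultimately show ?thesis
    using invariant_subspace_eigenvector[of ?V B x] x that by blast
qed

lemma eigenvalue_mult_self: "eigenvalue A k \<Longrightarrow> eigenvalue (A ** A) (k\<^sup>2)"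
  unfolding eigenvalue_def power2_eq_square
  by (metis matrix_vector_mul_assoc vector_scalar_commute vector_smult_assoc)

section \<open>Normal matrices\<close>

definition conj_transpose :: "complex ^ 'n ^ 'm \<Rightarrow> complex ^ 'm ^ 'n" where
  "conj_transpose A = map_matrix cnj (transpose A)"

definition normal_matrix :: "complex ^ 'n ^ 'n \<Rightarrow> bool" where
  "normal_matrix A \<longleftrightarrow> A ** conj_transpose A = conj_transpose A ** A"

lemma conj_transpose_nth [simp]: "conj_transpose A $ i $ j = cnj (A $ j $ i)"
  by (simp add: conj_transpose_def transpose_def)

lemma inner_mult_complex: "inner (a * b) c = inner b (cnj a * c)" for a b c :: complex
  by (simp add: inner_complex_def algebra_simps)

lemma inner_smult_complex: "inner (a *s x) y = inner x (cnj a *s y)" for x :: "complex ^ 'n"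
  by (simp add: inner_vec_def inner_mult_complex)

lemma inner_matrix_vec_conj_transpose: "inner (A *v x) y = inner x (conj_transpose A *v y)"
proof -
  have "inner (A *v x) y = (\<Sum>i\<in>UNIV. \<Sum>j\<in>UNIV. inner (x $ j) (cnj (A $ i $ j) * y $ i))"
    by (simp add: inner_vec_def matrix_vector_mult_def inner_sum_left inner_mult_complex)
  also have "\<dots> = (\<Sum>j\<in>UNIV. \<Sum>i\<in>UNIV. inner (x $ j) (cnj (A $ i $ j) * y $ i))"
    by (rule sum.swap)
  also have "\<dots> = inner x (conj_transpose A *v y)"
    by (simp add: inner_vec_def matrix_vector_mult_def inner_sum_right)
  finally show ?thesis .
qed

lemma normal_matrix_norm_eq:
  assumes "normal_matrix A"
  shows "norm (A *v x) = norm (conj_transpose A *v x)"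
proof -
  have "inner (A *v x) (A *v x) = inner x (conj_transpose A *v (A *v x))"
    by (rule inner_matrix_vec_conj_transpose)
  also have "\<dots> = inner (A *v (conj_transpose A *v x)) x"
    using assms by (simp add: matrix_vector_mul_assoc normal_matrix_def inner_commute)
  also have "\<dots> = inner (conj_transpose A *v x) (conj_transpose A *v x)"
    by (rule inner_matrix_vec_conj_transpose)
  finally show ?thesis
    by (simp add: norm_eq_sqrt_inner)
qed

lemma normal_matrix_eigenvector:
  assumes "normal_matrix A" and eigenvector: "A *v x = l *s x"
  shows "conj_transpose A *v x = cnj l *s x"
proof -
  let ?y = "conj_transpose A *v x"
  have "inner ?y ?y = inner (l *s x) (l *s x)"
    using normal_matrix_norm_eq[OF assms(1), of x] by (simp add: eigenvector norm_eq)
  moreover have "inner ?y (cnj l *s x) = inner (l *s x) (l *s x)"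
    by (metis eigenvector inner_commute inner_matrix_vec_conj_transpose inner_smult_complex
        vector_scalar_commute)
  moreover have "inner (cnj l *s x) (cnj l *s x) = inner (l *s x) (l *s x)"
    by (simp add: inner_smult_complex mult.commute)
  ultimately have "inner (?y - cnj l *s x) (?y - cnj l *s x) = 0"
    by (simp add: inner_diff inner_commute)
  then show ?thesis
    by simp
qed

lemma normal_matrix_combination_mult_eigenvector:
  assumes "normal_matrix A" "A *v x = l *s x"
  shows "(mat a ** A + mat b ** conj_transpose A) *v x = (a * l + b * cnj l) *s x"
  by (simp add: matrix_vector_mult_add_rdistrib assms normal_matrix_eigenvector[OF assms]
      flip: matrix_vector_mul_assoc)

lemma eigenvalue_normal_matrix_combination_iff:
  assumes "normal_matrix A"
  shows "eigenvalue (mat a ** A + mat b ** conj_transpose A) k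
    \<longleftrightarrow> (\<exists>l. eigenvalue A l \<and> k = a * l + b * cnj l)"
    (is "eigenvalue ?C k \<longleftrightarrow> _")
proof
  assume "eigenvalue ?C k"
  moreover have "conj_transpose A *v (A *v x) = A *v (conj_transpose A *v x)" for x
    using assms by (simp add: matrix_vector_mul_assoc normal_matrix_def)
  then have "?C ** A = A ** ?C"
    by (simp add: matrix_eq matrix_vector_mult_add_rdistrib matrix_vector_right_distrib
        vector_scalar_commute flip: matrix_vector_mul_assoc)
  ultimately obtain x l where x: "x \<noteq> 0" "?C *v x = k *s x" "A *v x = l *s x"
    by (rule commuting_common_eigenvector)
  then have "k *s x = (a * l + b * cnj l) *s x"
    using normal_matrix_combination_mult_eigenvector[OF assms] by metis
  then have "k = a * l + b * cnj l"
    using x(1) by (simp only: vector_mul_rcancel) simp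
  with x show "\<exists>l. eigenvalue A l \<and> k = a * l + b * cnj l"
    by (auto simp: eigenvalue_def)
next
  assume "\<exists>l. eigenvalue A l \<and> k = a * l + b * cnj l"
  then show "eigenvalue ?C k"
    using normal_matrix_combination_mult_eigenvector[OF assms] by (auto simp: eigenvalue_def)
qed

lemma eigenvalue_cnj_real_matrix:
  assumes real: "\<And>i j. A $ i $ j \<in> \<real>" and "eigenvalue A l"
  shows "eigenvalue A (cnj l)"
proof -
  obtain x where x: "x \<noteq> 0" "A *v x = l *s x"
    using assms(2) by (auto simp: eigenvalue_def)
  let ?y = "\<chi> i. cnj (x $ i)"
  have "(A *v ?y) $ i = cnj ((A *v x) $ i)" for i
    using real by (simp add: matrix_vector_mult_def Reals_cnj_iff)
  then have "A *v ?y = cnj l *s ?y"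
    by (simp add: x vec_eq_iff)
  moreover have "?y \<noteq> 0"
    using x(1) by (simp add: vec_eq_iff)
  ultimately show ?thesis
    by (auto simp: eigenvalue_def)
qed

section \<open>Rational eigenvalues of integer matrices\<close>

lemma det_cong:
  fixes A B :: "'a::unique_euclidean_ring ^ 'n ^ 'n"
  assumes "\<And>i j. [A $ i $ j = B $ i $ j] (mod q)"
  shows "[det A = det B] (mod q)"
  unfolding det_def by (intro cong_sum cong_mult cong_prod cong_refl assms)

lemma of_int_det: "of_int (det A) = det (map_matrix of_int A :: 'a::comm_ring_1 ^ 'n ^ 'n)"
  by (simp add: det_def)

lemma det_mat: "det (mat c :: 'a::comm_ring_1 ^ 'n ^ 'n) = c ^ CARD('n)"
  by (subst det_diagonal) (simp_all add: mat_def)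

lemma det_eq_0_if_kernel:
  fixes A :: "'a::field ^ 'n ^ 'n"
  assumes "A *v x = 0" "x \<noteq> 0"
  shows "det A = 0"
  using assms invertible_det_nz invertible_left_inverse matrix_left_invertible_ker by metis

lemma rational_eigenvalue_int_matrix:
  fixes C :: "complex ^ 'n ^ 'n"
  assumes "\<And>i j. C $ i $ j \<in> \<int>" "eigenvalue C k" "k \<in> \<rat>"
  shows "k \<in> \<int>"
proof -
  obtain a b :: int where "b > 0" "coprime a b" and k_eq: "k = of_int a / of_int b"
    using \<open>k \<in> \<rat>\<close> by (rule Rats_cases')
  obtain x where x: "x \<noteq> 0" "C *v x = k *s x"
    using assms(2) by (auto simp: eigenvalue_def)
  define D :: "int ^ 'n ^ 'n" where "D = (\<chi> i j. \<lfloor>Re (C $ i $ j)\<rfloor>)"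
  have D: "of_int (D $ i $ j) = C $ i $ j" for i j
    using assms(1)[of i j] by (auto simp: D_def elim: Ints_cases)
  let ?M = "mat a - mat b ** D"
  have "map_matrix of_int ?M = mat (of_int a) - mat (of_int b) ** C"
    by (simp add: vec_eq_iff D) (simp add: mat_def)
  then have "map_matrix of_int ?M *v x = 0"
    using \<open>b > 0\<close> by (simp add: matrix_vector_mult_diff_rdistrib k_eq x
        flip: matrix_vector_mul_assoc)
  then have "det (map_matrix of_int ?M :: complex ^ 'n ^ 'n) = 0"
    using x(1) by (rule det_eq_0_if_kernel)
  then have "det ?M = 0"
    by (simp flip: of_int_det)
  moreover have "[det ?M = det (mat a :: int ^ 'n ^ 'n)] (mod b)"
    by (rule det_cong) (simp add: cong_iff_dvd_diff)
  ultimately have "b dvd a ^ CARD('n)"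
    by (simp add: det_mat cong_sym_eq[of 0] cong_0_iff)
  moreover have "coprime b (a ^ CARD('n))"
    using \<open>coprime a b\<close> by (simp add: coprime_commute)
  ultimately have "b = 1"
    using \<open>b > 0\<close> coprime_common_divisor[of b "a ^ CARD('n)" b] by simp
  then show ?thesis
    by (simp add: k_eq)
qed

lemma Im_square_in_Ints_if_normal_int_matrix:
  assumes normal: "normal_matrix A" and int: "\<And>i j. A $ i $ j \<in> \<int>"
    and "eigenvalue A l" and rational: "(2 * Im l)\<^sup>2 \<in> \<rat>"
  shows "(2 * Im l)\<^sup>2 \<in> \<int>"
proof -
  define B where "B = mat 1 ** A + mat (- 1) ** conj_transpose A"
  have "eigenvalue B (l - cnj l)"
    unfolding B_def eigenvalue_normal_matrix_combination_iff[OF normal] using assms(3) by auto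
  then have "eigenvalue (B ** B) ((l - cnj l)\<^sup>2)"
    by (rule eigenvalue_mult_self)
  moreover have "(l - cnj l)\<^sup>2 = of_real (- (2 * Im l)\<^sup>2)"
    by (simp add: complex_diff_cnj power_mult_distrib)
  ultimately have "eigenvalue (B ** B) (of_real (- (2 * Im l)\<^sup>2))"
    by simp
  moreover have "cnj (A $ i $ j) \<in> \<int>" for i j
    using int[of i j] by (auto elim: Ints_cases)
  then have "B $ i $ j \<in> \<int>" for i j
    by (simp add: B_def int)
  then have "(B ** B) $ i $ j \<in> \<int>" for i j
    by (auto simp: matrix_matrix_mult_def intro!: Ints_mult)
  moreover have "complex_of_real (- (2 * Im l)\<^sup>2) \<in> \<rat>"
    using rational by (simp only: Rats_complex_of_real_iff Rats_minus_iff)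
  ultimately have "complex_of_real (- (2 * Im l)\<^sup>2) \<in> \<int>"
    using rational_eigenvalue_int_matrix by blast
  then show ?thesis
    by (simp only: of_real_in_Ints_iff minus_in_Ints_iff)
qed

section \<open>Mixed graphs with normal adjacency matrix\<close>

lemma conj_transpose_adj_matrix: "conj_transpose (adj_matrix E) = transpose (adj_matrix E)"
  by (simp add: vec_eq_iff adj_matrix_def transpose_def)

lemma herm_adj_matrix_eq_combination:
  "herm_adj_matrix E
     = mat (1 + omega3) ** adj_matrix E + mat (cnj (1 + omega3)) ** conj_transpose (adj_matrix E)"
  by (auto simp: vec_eq_iff herm_adj_matrix_def adj_matrix_def omega3_def field_simps)

lemma eigenvalue_herm_adj_matrix_iff:
  assumes "normal_matrix (adj_matrix E)"
  shows "eigenvalue (herm_adj_matrix E) k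
    \<longleftrightarrow> (\<exists>l. eigenvalue (adj_matrix E) l \<and> k = of_real (Re l - sqrt 3 * Im l))"
proof -
  have "(1 + omega3) * l + cnj (1 + omega3) * cnj l = of_real (Re l - sqrt 3 * Im l)" for l
    by (simp add: omega3_def complex_eq_iff field_simps)
  then show ?thesis
    by (simp only: herm_adj_matrix_eq_combination
        eigenvalue_normal_matrix_combination_iff[OF assms])
qed

lemma eisenstein_ints_iff_Re_Im:
  "l \<in> eisenstein_ints
    \<longleftrightarrow> (\<exists>a b. Re l = of_int a - of_int b / 2 \<and> Im l = of_int b * sqrt 3 / 2)"
  by (auto simp: eisenstein_ints_def omega3_def complex_eq_iff)

lemma Re_minus_sqrt3_Im_in_Ints:
  assumes "l \<in> eisenstein_ints"
  shows "Re l - sqrt 3 * Im l \<in> \<int>"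
proof -
  obtain a b :: int where "Re l = of_int a - of_int b / 2" "Im l = of_int b * sqrt 3 / 2"
    using assms unfolding eisenstein_ints_iff_Re_Im by blast
  then have "Re l - sqrt 3 * Im l = of_int a - of_int b / 2 - sqrt 3 * (of_int b * sqrt 3 / 2)"
    by simp
  also have "\<dots> = of_int (a - 2 * b)"
    by (simp add: algebra_simps)
  finally have "Re l - sqrt 3 * Im l = of_int (a - 2 * b)" .
  then show ?thesis
    by simp
qed

lemma eisenstein_intsI:
  assumes "Re l - sqrt 3 * Im l \<in> \<int>" "Re l + sqrt 3 * Im l \<in> \<int>" "(2 * Im l)\<^sup>2 \<in> \<int>"
  shows "l \<in> eisenstein_ints"
proof -
  obtain m n z where m: "Re l - sqrt 3 * Im l = of_int m"
    and n: "Re l + sqrt 3 * Im l = of_int n" and z: "(2 * Im l)\<^sup>2 = of_int z"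
    using assms by (auto elim!: Ints_cases)
  have diff: "of_int (n - m) = sqrt 3 * (2 * Im l)"
    using m n by simp
  have "real_of_int ((n - m)\<^sup>2) = (sqrt 3 * (2 * Im l))\<^sup>2"
    by (simp only: of_int_power diff)
  also have "\<dots> = of_int (3 * z)"
    by (simp only: power_mult_distrib[of "sqrt 3"] z) simp
  finally have "(n - m)\<^sup>2 = 3 * z"
    by linarith
  then have "3 dvd n - m"
    using prime_dvd_power[of "3 :: int" "n - m" 2] by simp
  then obtain b where b: "n - m = 3 * b"
    by (rule dvdE)
  have "sqrt 3 * Im l = sqrt 3 * (of_int b * sqrt 3 / 2)"
    using diff unfolding b by (simp add: algebra_simps)
  then have Im: "Im l = of_int b * sqrt 3 / 2"
    by simp
  moreover have "Re l = of_int (m + 2 * b) - of_int b / 2"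
    using m by (simp add: Im algebra_simps)
  ultimately show ?thesis
    unfolding eisenstein_ints_iff_Re_Im by blast
qed

theorem eisenstein_integral_iff_HS_integral_if_normal:
  assumes normal: "normal_matrix (adj_matrix E)"
  shows "eisenstein_integral E \<longleftrightarrow> HS_integral E"
proof
  assume "eisenstein_integral E"
  then show "HS_integral E"
    unfolding eisenstein_integral_def HS_integral_def eigenvalue_herm_adj_matrix_iff[OF normal]
    by (auto simp only: of_real_in_Ints_iff intro!: Re_minus_sqrt3_Im_in_Ints)
next
  assume HS: "HS_integral E"
  have minus: "Re l - sqrt 3 * Im l \<in> \<int>" if "eigenvalue (adj_matrix E) l" for l
    using HS that unfolding HS_integral_def eigenvalue_herm_adj_matrix_iff[OF normal]
    by (metis of_real_in_Ints_iff)
  show "eisenstein_integral E"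
    unfolding eisenstein_integral_def
  proof (intro allI impI)
    fix l assume l: "eigenvalue (adj_matrix E) l"
    have "eigenvalue (adj_matrix E) (cnj l)"
      using l by (intro eigenvalue_cnj_real_matrix) (simp_all add: adj_matrix_def)
    from minus[OF this] have plus: "Re l + sqrt 3 * Im l \<in> \<int>"
      by simp
    have "(2 * Im l)\<^sup>2 = ((Re l + sqrt 3 * Im l) - (Re l - sqrt 3 * Im l))\<^sup>2 / 3"
      by (simp add: power_mult_distrib)
    also have "\<dots> \<in> \<rat>"
      using Ints_diff[OF plus minus[OF l]] Ints_subset_Rats
      by (intro Rats_divide Rats_power) (blast, simp)
    finally have "(2 * Im l)\<^sup>2 \<in> \<int>"
      using normal l by (intro Im_square_in_Ints_if_normal_int_matrix)
        (simp_all add: adj_matrix_def)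
    then show "l \<in> eisenstein_ints"
      using minus[OF l] plus by (intro eisenstein_intsI)
  qed
qed

lemma normal_adj_matrix_cayley_arcs:
  fixes S :: "'a::{ab_group_add, finite} set"
  shows "normal_matrix (adj_matrix (cayley_arcs S))"
proof -
  let ?A = "adj_matrix (cayley_arcs S)"
  have "(\<Sum>w\<in>UNIV. ?A $ u $ w * ?A $ v $ w) = (\<Sum>w\<in>UNIV. ?A $ w $ u * ?A $ w $ v)" for u v
    by (rule sum.reindex_bij_witness[of _ "\<lambda>w. u + v - w" "\<lambda>w. u + v - w"])
      (auto simp: adj_matrix_def cayley_arcs_def)
  then show ?thesis
    by (simp add: normal_matrix_def conj_transpose_adj_matrix vec_eq_iff matrix_matrix_mult_def
        transpose_def)
qed

theorem theorem5p9:
  fixes S :: "'a::{ab_group_add, finite} set"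
  assumes "0 \<notin> S"
  shows "eisenstein_integral (cayley_arcs S) \<longleftrightarrow> HS_integral (cayley_arcs S)"
  by (rule eisenstein_integral_iff_HS_integral_if_normal) (rule normal_adj_matrix_cayley_arcs)

end
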